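(* Let $\eta\in(0,1)$, let $\mathcal D$ be a dyadic system in $\mathbb R^n$, and let $\mathcal S\subseteq\mathcal D$ be a graded (contracting) $\eta$-sparse family in $[0,1]^n$ with degree $K_{\mathcal S}$. Let $1<t<1-\frac{\log_2(1-\eta)}{nK_{\mathcal S}}$, and let $$\mathbb A_{\mathcal S}^tf(x):=\sum_{Q\in\mathcal S}\frac{\mathbf 1_Q(x)}{|Q|^t}\int_Q|f(y)|\,dy$$ be the associated hypersingular sparse operator. Then the following statements hold. (1) (Off-critical line estimate) $\mathbb A_{\mathcal S}^t$ extends to a bounded operator from $L^p(\mathbb R^n)$ to $L^q(\mathbb R^n)$ whenever $$\left(\frac1p,\frac1q\right)\in[0,1]^2\quad\text{and}\quad\frac1q-\frac1p>\frac{nK_{\mathcal S}(t-1)}{-\log_2(1-\eta)}.$$ (2) (Critical line estimate) $\mathbb A_{\mathcal S}^t$ extends to a bounded operator from $L^p(\mathbb R^n)$ to $L^{q,\infty}(\mathbb R^n)$ whenever $$\left(\frac1p,\frac1q\right)\in[0,1]^2\quad\text{and}\quad\frac1q-\frac1p=\frac{nK_{\mathcal S}(t-1)}{-\log_2(1-\eta)}.$$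
   Context: A dyadic system in $\mathbb R^n$ is a standard dyadic grid of cubes (side lengths integer powers of $2$, nested, cubes of the same generation disjoint), here containing the unit cube, written $[0,1]^n$. $|Q|$ is Lebesgue measure and $\ell(Q)$ is the side length of $Q$. A collection $\mathcal S\subset\mathcal D$ is (contracting) $\eta$-sparse if there are measurable sets $\{E(Q)\}_{Q\in\mathcal S}$ such that: (i) $E(Q)\subseteq Q$ for all $Q\in\mathcal S$; (ii) $|E(Q)|\ge\eta|Q|$ for all $Q\in\mathcal S$; (iii) $E(Q)\cap Q'=\emptyset$ for every $Q'\in\mathcal S$ with $Q'\subsetneq Q$. Layers and degree: let $\mathcal G\subseteq\mathcal D$ be a collection of dyadic cubes all contained in $[0,1]^n$. Let $\mathcal G^{(0)}$ be the collection of maximal cubes of $\mathcal G$, and assume $\mathcal G^{(0)}=\{[0,1]^n\}$. Inductively, for $j\ge1$ let $\mathcal G^{(j)}$ (the $j$-th layer) be the collection of maximal cubes of $\mathcal G\setminus\bigcup_{i<j}\mathcal G^{(i)}$. Put $\mathfrak G_0:=\ell([0,1]^n)=1$ and $\mathfrak G_j:=\inf_{Q\in\mathcal G^{(j)}}\ell(Q)$. $\mathcal G$ is graded if $$K_{\mathcal G}:=\sup_{j\ge0}\log_2\frac{\mathfrak G_j}{\mathfrak G_{j+1}}<\infty,$$ the supremum being over those $j$ for which $\mathcal G^{(j+1)}\ne\emptyset$; $K_{\mathcal G}$ is called the degree of $\mathcal G$. It is assumed that $\mathcal G^{(1)}\neq\emptyset$ (so that $1\le K_{\mathcal G}<\infty$).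 $L^{q,\infty}(\mathbb R^n)$ is weak $L^q$ with $\|g\|_{L^{q,\infty}}:=\sup_{\lambda>0}\lambda|\{|g|>\lambda\}|^{1/q}$. Boundedness means $\|\mathbb A_{\mathcal S}^tf\|\le C\|f\|_{L^p(\mathbb R^n)}$ in the relevant target (quasi-)norm with $C$ independent of $f$. *)

theory Defs
  imports "HOL-Probability.Essential_Supremum"
begin

section \<open>Dyadic systems\<close>

definition hcube :: "real^'n \<Rightarrow> real \<Rightarrow> (real^'n) set" where
  "hcube a l = {x. \<forall>i. a $ i \<le> x $ i \<and> x $ i < a $ i + l}"

(* The cube written [0,1]^n: dyadic cubes are half-open, so that cubes of the same
   generation are genuinely disjoint. *)
definition unit_cube :: "(real^'n) set" where
  "unit_cube = hcube 0 1"

definition side :: "(real^'n) set \<Rightarrow> real" where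
  "side Q = (THE l. l > 0 \<and> (\<exists>a. Q = hcube a l))"

definition dyadic_system :: "(real^'n) set set \<Rightarrow> bool" where
  "dyadic_system D \<longleftrightarrow>
     (\<forall>Q\<in>D. \<exists>a (k::int). Q = hcube a (2 powi k)) \<and>
     (\<forall>k::int. partition_on UNIV {Q \<in> D. side Q = 2 powi k}) \<and>
     (\<forall>Q\<in>D. \<forall>R\<in>D. Q \<inter> R = {} \<or> Q \<subseteq> R \<or> R \<subseteq> Q)"


section \<open>Contracting sparse families\<close>

definition contracting_sparse :: "real \<Rightarrow> (real^'n) set set \<Rightarrow> bool" where
  "contracting_sparse \<eta> S \<longleftrightarrow>
     (\<exists>E. \<forall>Q\<in>S. E Q \<in> sets lebesgue \<and> E Q \<subseteq> Q \<and>
            measure lebesgue (E Q) \<ge> \<eta> * measure lebesgue Q \<and>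
            (\<forall>Q'\<in>S. Q' \<subset> Q \<longrightarrow> E Q \<inter> Q' = {}))"


section \<open>Layers and degree\<close>

definition maximal_cubes :: "(real^'n) set set \<Rightarrow> (real^'n) set set" where
  "maximal_cubes G = {Q \<in> G. \<not> (\<exists>R\<in>G. Q \<subset> R)}"

fun layer :: "(real^'n) set set \<Rightarrow> nat \<Rightarrow> (real^'n) set set" where
  "layer G j = maximal_cubes (G - (\<Union>i\<in>{..<j}. layer G i))"

(* The recursion equation is not a terminating rewrite rule. *)
declare layer.simps [simp del]

definition layer_scale :: "(real^'n) set set \<Rightarrow> nat \<Rightarrow> real" where
  "layer_scale G j = (INF Q\<in>layer G j. side Q)"

(* A layer may be infinite with infimal side length 0; the ratio of consecutive scales is
   then infinite, whereas division by 0 in the reals would yield 0. *)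
definition scale_gap :: "(real^'n) set set \<Rightarrow> nat \<Rightarrow> ereal" where
  "scale_gap G j =
     (if layer_scale G (Suc j) = 0 then \<infinity>
      else ereal (log 2 (layer_scale G j / layer_scale G (Suc j))))"

definition layer_degree :: "(real^'n) set set \<Rightarrow> ereal" where
  "layer_degree G = (SUP j\<in>{j. layer G (Suc j) \<noteq> {}}. scale_gap G j)"

definition graded :: "(real^'n) set set \<Rightarrow> bool" where
  "graded G \<longleftrightarrow> layer_degree G < \<infinity>"


section \<open>Lebesgue and weak Lebesgue norms\<close>

(* Power with exponent a >= 0. For a = 0 the conventions are \<infinity>^0 = 1 and 0^0 = 0; they
   matter only for the exponent 1 / q with q = \<infinity>, where they turn weak_L_norm into
   the essential supremum. *)
definition epowr :: "ennreal \<Rightarrow> real \<Rightarrow> ennreal" where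
  "epowr x a = (if x = top then (if a = 0 then 1 else top) else ennreal (enn2real x powr a))"

(* Exponents p range over [1,\<infinity>] as extended nonnegative reals, so that 1 / top = 0. *)
definition L_norm :: "ennreal \<Rightarrow> (real^'n \<Rightarrow> ennreal) \<Rightarrow> ennreal" where
  "L_norm p g =
     (if p = top then esssup lebesgue g
      else epowr (\<integral>\<^sup>+x. epowr (g x) (enn2real p) \<partial>lebesgue) (enn2real (1 / p)))"

definition weak_L_norm :: "ennreal \<Rightarrow> (real^'n \<Rightarrow> ennreal) \<Rightarrow> ennreal" where
  "weak_L_norm q g =
     (SUP s\<in>{0<..}. ennreal s * epowr (emeasure lebesgue {x. g x > ennreal s}) (enn2real (1 / q)))"

(* Boundedness from L^p into the space with quasi-norm N, for operators whose values are
   nonnegative and possibly infinite at some points. *)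
definition bounded_from_L ::
  "ennreal \<Rightarrow> ((real^'n \<Rightarrow> ennreal) \<Rightarrow> ennreal) \<Rightarrow>
     ((real^'n \<Rightarrow> complex) \<Rightarrow> real^'n \<Rightarrow> ennreal) \<Rightarrow> bool" where
  "bounded_from_L p N T \<longleftrightarrow>
     (\<exists>C::real. \<forall>f \<in> borel_measurable lebesgue.
        L_norm p (\<lambda>x. ennreal (norm (f x))) < top \<longrightarrow>
        T f \<in> borel_measurable lebesgue \<and>
        N (T f) \<le> ennreal C * L_norm p (\<lambda>x. ennreal (norm (f x))))"


section \<open>The hypersingular sparse operator\<close>

definition sparse_op ::
  "(real^'n) set set \<Rightarrow> real \<Rightarrow> (real^'n \<Rightarrow> complex) \<Rightarrow> real^'n \<Rightarrow> ennreal" where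
  "sparse_op S t f x =
     (\<Sum>\<^sub>\<infinity>Q\<in>S. indicator Q x / ennreal (measure lebesgue Q powr t) *
        (\<integral>\<^sup>+y\<in>Q. ennreal (norm (f y)) \<partial>lebesgue))"

end

theory Submission
  imports Defs
begin

text \<open>
  Why the theorem holds. Let \<open>b = 2^(nK(t-1))\<close> and let \<open>\<Omega>(j)\<close> be the union of the \<open>j\<close>-th layer.
  The degree forces every cube of the \<open>j\<close>-th layer to have measure at least \<open>2^(-nKj)\<close>
  (\<open>measure_ge_degree\<close>), so the factor \<open>|Q|^(1-t)\<close> that separates \<open>|Q|^(-t) \<integral>\<^sub>Q |f|\<close> from the mean
  of \<open>|f|\<close> over \<open>Q\<close> is at most \<open>b^j\<close>. A point lies in at most one cube of each layer, whence the
  pointwise bound \<open>A f \<le> w * M f\<close> (\<open>sparse_op_le\<close>). Here \<open>w\<close> is the sum over \<open>j\<close> of \<open>b^j\<close> times the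
  indicator of \<open>\<Omega>(j)\<close>, and \<open>M\<close> is the maximal function over the cubes of the family.

  Sparseness enters through \<open>region_decay\<close>: the set \<open>E(Q)\<close> of a cube \<open>Q\<close> in one layer is disjoint
  from all cubes of the next layer, so \<open>|\<Omega>(j)| \<le> (1-\<eta>)^j\<close>. Since \<open>w\<close> is a geometric sum, comparable
  to \<open>b^k\<close> on \<open>\<Omega>(k) - \<Omega>(k+1)\<close>, it belongs to weak \<open>L^(1/s)\<close>, where \<open>s\<close> is fixed by
  \<open>b^(-1/s) = 1-\<eta>\<close> (\<open>weight_distribution\<close>); this \<open>s\<close> is exactly the critical value
  \<open>nK(t-1) / (-log\<^sub>2 (1-\<eta>))\<close>. The maximal function maps \<open>L^p\<close> into weak \<open>L^p\<close> for all \<open>p \<ge> 1\<close>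
  (\<open>maxfun_weak_type\<close>, \<open>maxfun_le_const\<close>). Hoelder's inequality for weak spaces, in the form of a
  balanced splitting of the superlevel set of a product, therefore puts \<open>A f\<close> into weak \<open>L^r\<close> with
  \<open>1/r = 1/p + s\<close> (\<open>sparse_op_distribution\<close>). That is the critical estimate. Off the critical line
  the target exponent \<open>q\<close> is strictly smaller than \<open>r\<close>, and weak \<open>L^r\<close> embeds into \<open>L^q\<close> for
  functions supported in the unit cube (\<open>nn_integral_epowr_le\<close>).

  The norm estimates are obtained for every real \<open>N > 0\<close> that dominates the norm of \<open>f\<close>. This permits
  division by \<open>N\<close> and covers functions of norm zero through the limit \<open>N \<rightarrow> 0\<close>
  (\<open>bounded_from_L_I\<close>).
\<close>

section \<open>Half-open cubes\<close>


lemma borel_hcube [measurable]: "hcube a l \<in> sets borel"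
proof -
  have "hcube a l = (\<Inter>i. {x. a $ i \<le> x $ i} \<inter> {x. x $ i < a $ i + l})"
    by (auto simp: hcube_def)
  also have "\<dots> \<in> sets borel"
    by (intro sets.finite_INT borel_closed borel_open sets.Int
        closed_halfspace_component_ge_cart open_halfspace_component_lt_cart) auto
  finally show ?thesis .
qed

lemma emeasure_hcube:
  fixes a :: "real^'n"
  assumes "0 \<le> l"
  shows "emeasure lebesgue (hcube a l) = ennreal (l ^ CARD('n))"
proof -
  let ?b = "a + (\<chi> i. l)"
  have sub: "box a ?b \<subseteq> hcube a l" "hcube a l \<subseteq> cbox a ?b"
    by (auto simp: hcube_def mem_box_cart less_imp_le)
  have ne: "cbox a ?b \<noteq> {}"
    using assms by (auto simp: interval_ne_empty_cart)
  have c: "emeasure lborel (cbox a ?b) = ennreal (l ^ CARD('n))"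
    using content_cbox_cart[OF ne] by (simp add: emeasure_eq_ennreal_measure[OF less_imp_neq[OF emeasure_lborel_cbox_finite, unfolded infinity_ennreal_def]])
  have o: "emeasure lborel (box a ?b) = ennreal (l ^ CARD('n))"
    using c by (simp add: emeasure_lborel_cbox_eq emeasure_lborel_box_eq)
  have "emeasure lborel (hcube a l) = ennreal (l ^ CARD('n))"
  proof (rule antisym)
    show "emeasure lborel (hcube a l) \<le> ennreal (l ^ CARD('n))"
      using emeasure_mono[OF sub(2), of lborel] c by simp
    show "ennreal (l ^ CARD('n)) \<le> emeasure lborel (hcube a l)"
      using emeasure_mono[OF sub(1), of lborel] o by simp
  qed
  then show ?thesis by simp
qed

lemma measure_hcube:
  fixes a :: "real^'n"
  assumes "0 \<le> l"
  shows "measure lebesgue (hcube a l) = l ^ CARD('n)"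
  using emeasure_hcube[OF assms, of a] assms by (simp add: measure_def)

lemma side_hcube:
  fixes a :: "real^'n"
  assumes "0 < l"
  shows "side (hcube a l) = l"
  unfolding side_def
proof (rule the_equality)
  show "l > 0 \<and> (\<exists>b. hcube a l = hcube b l)" using assms by blast
  fix l' assume *: "l' > 0 \<and> (\<exists>b. hcube a l = hcube b l')"
  then obtain b where "hcube a l = hcube b l'" by blast
  then have "l ^ CARD('n) = l' ^ CARD('n)"
    using measure_hcube[of l a] measure_hcube[of l' b] assms * by simp
  then show "l' = l" using assms * power_inject_base[of l' "CARD('n) - 1" l] by simp
qed

lemma hcube_nonempty: "0 < l \<Longrightarrow> hcube a l \<noteq> {}"
  by (auto simp: hcube_def intro!: exI[of _ a])

lemma side_mono:
  fixes a b :: "real^'n"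
  assumes "hcube a l \<subseteq> hcube b m" "0 < l" "0 < m"
  shows "l \<le> m"
proof -
  have "emeasure lebesgue (hcube a l) \<le> emeasure lebesgue (hcube b m)"
    using assms(1) by (intro emeasure_mono) auto
  then have "l ^ CARD('n) \<le> m ^ CARD('n)"
    using assms(2,3) by (simp only: emeasure_hcube less_imp_le ennreal_le_iff zero_le_power)
  then show ?thesis
    using assms power_le_imp_le_base[of l "CARD('n) - 1" m] by simp
qed

section \<open>Forests of cubes and their layers\<close>


text \<open>
  The order structure of a subfamily of a dyadic system below a top cube: by the nesting property
  the cubes that contain a given one form a chain, and finiteness of these chains is what makes
  the layer construction reach every cube, even when the family is infinite.
\<close>

locale cube_forest =
  fixes S :: "(real^'n) set set"
  assumes cube: "Q \<in> S \<Longrightarrow> \<exists>a l. 0 < l \<and> Q = hcube a l"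
    and nested: "Q \<in> S \<Longrightarrow> R \<in> S \<Longrightarrow> Q \<inter> R = {} \<or> Q \<subseteq> R \<or> R \<subseteq> Q"
    and finite_ancestors: "Q \<in> S \<Longrightarrow> finite {R \<in> S. Q \<subset> R}"
begin

definition depth :: "(real^'n) set \<Rightarrow> nat" where
  "depth Q = card {R \<in> S. Q \<subset> R}"

lemma cube_sets [measurable]: "Q \<in> S \<Longrightarrow> Q \<in> sets lebesgue"
  using cube borel_hcube by fastforce

lemma cube_nonempty: "Q \<in> S \<Longrightarrow> Q \<noteq> {}"
  using cube hcube_nonempty by metis

lemma cube_measure:
  assumes "Q \<in> S"
  shows "0 < side Q" "measure lebesgue Q = side Q ^ CARD('n)"
    and "emeasure lebesgue Q = ennreal (measure lebesgue Q)" "0 < measure lebesgue Q"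
proof -
  obtain a l where Q: "0 < l" "Q = hcube a l" using cube[OF assms] by blast
  note m = measure_hcube[of l a] emeasure_hcube[of l a]
  show "0 < side Q" "measure lebesgue Q = side Q ^ CARD('n)"
    "emeasure lebesgue Q = ennreal (measure lebesgue Q)" "0 < measure lebesgue Q"
    unfolding Q(2) side_hcube[OF Q(1)] using m Q(1) by (simp_all only: less_imp_le zero_less_power)
qed

lemma depth_less:
  assumes "Q \<in> S" "R \<in> S" "Q \<subset> R"
  shows "depth R < depth Q"
  unfolding depth_def using assms by (intro psubset_card_mono finite_ancestors) auto

lemma same_depth_disjoint:
  assumes "Q \<in> S" "R \<in> S" "Q \<noteq> R" "depth Q = depth R"
  shows "Q \<inter> R = {}"
  using nested[OF assms(1,2)] depth_less[of Q R] depth_less[of R Q] assms by auto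

text \<open>
  The ancestors of \<open>Q\<close> form a chain because they all contain the nonempty set \<open>Q\<close>. Its smallest
  member has all the others as ancestors, hence exactly one fewer.
\<close>

lemma parent:
  assumes "Q \<in> S" "depth Q = Suc j"
  obtains R where "R \<in> S" "Q \<subset> R" "depth R = j"
proof -
  let ?A = "{R \<in> S. Q \<subset> R}"
  have fin: "finite ?A" and ne: "?A \<noteq> {}"
    using finite_ancestors[OF assms(1)] assms(2) unfolding depth_def by (simp, metis card.empty nat.distinct(1))
  from finite_has_minimal[OF fin ne]
  obtain R where R: "R \<in> ?A" "\<forall>T\<in>?A. T \<subseteq> R \<longrightarrow> R = T" ..
  have "?A = insert R {T \<in> S. R \<subset> T}"
  proof (intro equalityI subsetI)
    fix T assume T: "T \<in> ?A"
    have "T \<inter> R \<noteq> {}" using T R(1) cube_nonempty[OF assms(1)] by auto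
    then show "T \<in> insert R {T \<in> S. R \<subset> T}"
      using nested[of T R] T R by auto
  qed (use R in auto)
  then have "Suc j = Suc (depth R)"
    using assms(2) card_insert_disjoint[of "{T \<in> S. R \<subset> T}" R] finite_ancestors[of R] R(1)
    unfolding depth_def by auto
  then show thesis using that R(1) by auto
qed

text \<open>
  Identifies the recursively defined layers with the level sets of the number of ancestors: a cube
  of too large depth is not maximal because of its parent, while all cubes above one of depth \<open>j\<close>
  have smaller depth and have been removed.
\<close>

lemma layer_eq_depth: "layer S j = {Q \<in> S. depth Q = j}"
proof (induction j rule: less_induct)
  case (less j)
  have "S - (\<Union>i\<in>{..<j}. layer S i) = {Q \<in> S. j \<le> depth Q}"
    using less.IH by (auto simp: not_less[symmetric])
  then have "layer S j = maximal_cubes {Q \<in> S. j \<le> depth Q}"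
    by (simp add: layer.simps[of S j])
  also have "\<dots> = {Q \<in> S. depth Q = j}"
  proof (intro equalityI subsetI)
    fix Q assume Q: "Q \<in> maximal_cubes {Q \<in> S. j \<le> depth Q}"
    then have QS: "Q \<in> S" "j \<le> depth Q" by (auto simp: maximal_cubes_def)
    show "Q \<in> {Q \<in> S. depth Q = j}"
    proof (rule ccontr)
      assume "Q \<notin> {Q \<in> S. depth Q = j}"
      then obtain m where m: "depth Q = Suc m" "j \<le> m"
        using QS by (cases "depth Q") auto
      obtain R where "R \<in> S" "Q \<subset> R" "depth R = m" using parent[OF QS(1) m(1)] .
      then show False using Q m(2) by (auto simp: maximal_cubes_def)
    qed
  next
    fix Q assume "Q \<in> {Q \<in> S. depth Q = j}"
    then show "Q \<in> maximal_cubes {Q \<in> S. j \<le> depth Q}"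
      using depth_less[of Q] by (fastforce simp: maximal_cubes_def)
  qed
  finally show ?case .
qed

lemma below_maximal:
  assumes "B \<subseteq> S" "Q \<in> B"
  obtains R where "R \<in> maximal_cubes B" "Q \<subseteq> R"
proof -
  let ?A = "{R \<in> B. Q \<subseteq> R}"
  have "?A \<subseteq> insert Q {R \<in> S. Q \<subset> R}" using assms by auto
  then have "finite ?A"
    using finite_ancestors[of Q] assms by (meson finite.insertI finite_subset subsetD)
  moreover have "?A \<noteq> {}" using assms by auto
  ultimately have "\<exists>R\<in>?A. \<forall>T\<in>?A. R \<subseteq> T \<longrightarrow> R = T" by (rule finite_has_maximal)
  then obtain R where R: "R \<in> B" "Q \<subseteq> R" "\<forall>T\<in>?A. R \<subseteq> T \<longrightarrow> R = T" by auto
  have "R \<in> maximal_cubes B"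
    unfolding maximal_cubes_def using R by auto
  then show thesis using that R(2) by blast
qed

lemma disjoint_maximal:
  assumes "B \<subseteq> S"
  shows "disjoint_family_on (\<lambda>Q. Q) (maximal_cubes B)"
proof (unfold disjoint_family_on_def, intro ballI impI)
  fix Q R assume QR: "Q \<in> maximal_cubes B" "R \<in> maximal_cubes B" "Q \<noteq> R"
  then have "\<not> Q \<subseteq> R" "\<not> R \<subseteq> Q" by (auto simp: maximal_cubes_def)
  moreover have "Q \<in> S" "R \<in> S" using QR assms by (auto simp: maximal_cubes_def)
  ultimately show "Q \<inter> R = {}" using nested[of Q R] by auto
qed

end

text \<open>
  Ancestors inside the unit cube are finite in number: there are finitely many admissible
  side lengths between that of \<open>Q\<close> and \<open>1\<close>, and two ancestors of the same side length meet in \<open>Q\<close>, so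
  they coincide.
\<close>

lemma cube_forest_dyadic:
  fixes D :: "(real^'n) set set"
  assumes D: "dyadic_system D" and S: "S \<subseteq> D" and U: "\<And>Q. Q \<in> S \<Longrightarrow> Q \<subseteq> unit_cube"
  shows "cube_forest S"
proof
  have D1: "\<exists>a (k::int). Q = hcube a (2 powi k)" if "Q \<in> D" for Q
    using D that by (auto simp: dyadic_system_def)
  have D2: "partition_on UNIV {Q \<in> D. side Q = 2 powi k}" for k
    using D by (auto simp: dyadic_system_def)
  show "\<exists>a l. 0 < l \<and> Q = hcube a l" if QS: "Q \<in> S" for Q
  proof -
    obtain a k where "Q = hcube a (2 powi k)" using D1 QS S by blast
    then show ?thesis by (intro exI[of _ a] exI[of _ "2 powi k"]) simp
  qed
  show "Q \<inter> R = {} \<or> Q \<subseteq> R \<or> R \<subseteq> Q" if "Q \<in> S" "R \<in> S" for Q R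
    using D that S unfolding dyadic_system_def by blast
  fix Q assume Q: "Q \<in> S"
  obtain a k where Qk: "Q = hcube a (2 powi k)" using D1 Q S by blast
  let ?A = "{R \<in> S. Q \<subset> R}"
  have "side R \<in> (\<lambda>m. 2 powi m) ` {k..0}" if R: "R \<in> ?A" for R
  proof -
    obtain b m where Rm: "R = hcube b (2 powi m)" using D1 R S by blast
    have "(2::real) powi k \<le> 2 powi m" "(2::real) powi m \<le> 1"
      using side_mono[of a "2 powi k" b "2 powi m"] side_mono[of b "2 powi m" 0 1] R U[of R] Qk Rm
      by (simp_all add: unit_cube_def psubset_imp_subset)
    then have "k \<le> m" "m \<le> 0"
      using power_int_strict_increasing[of m k "2::real"] power_int_strict_increasing[of 0 m "2::real"]
      by (auto simp: not_le[symmetric])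
    then show ?thesis by (simp add: Rm side_hcube)
  qed
  moreover have "inj_on side ?A"
  proof (rule inj_onI)
    fix R T assume R: "R \<in> ?A" and T: "T \<in> ?A" and eq: "side R = side T"
    obtain b m where Rm: "R = hcube b (2 powi m)" using D1 R S by blast
    have "side R = 2 powi m" by (simp add: Rm side_hcube)
    then have "R \<in> {Q \<in> D. side Q = 2 powi m}" "T \<in> {Q \<in> D. side Q = 2 powi m}"
      using R T S eq by auto
    moreover have "R \<inter> T \<noteq> {}"
      using R T hcube_nonempty[of "2 powi k" a] Qk by auto
    ultimately show "R = T"
      using partition_onD2[OF D2[of m]] by (auto simp: disjoint_def)
  qed
  ultimately show "finite ?A"
    by (intro inj_on_finite[of side ?A "(\<lambda>m. 2 powi m) ` {k..0}"]) auto
qed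

section \<open>Geometric decay of the layers\<close>

context cube_forest
begin

definition region :: "nat \<Rightarrow> (real^'n) set" where
  "region j = \<Union> (layer S j)"

lemma region_iff: "x \<in> region j \<longleftrightarrow> (\<exists>Q\<in>S. x \<in> Q \<and> depth Q = j)"
  by (auto simp: region_def layer_eq_depth)

lemma region_Suc: "region (Suc j) \<subseteq> region j"
proof
  fix x assume "x \<in> region (Suc j)"
  then obtain Q where "Q \<in> S" "x \<in> Q" "depth Q = Suc j" by (auto simp: region_iff)
  then show "x \<in> region j" using parent[of Q j] by (metis psubsetD region_iff)
qed

lemma region_antimono: "i \<le> j \<Longrightarrow> region j \<subseteq> region i"
  using lift_Suc_antimono_le[of region, OF region_Suc] .

text \<open>
  The cubes of a layer are pairwise disjoint, so a lower bound on their measures limits how many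
  of them fit into a set of finite measure.
\<close>

lemma finite_layer:
  assumes U: "U \<in> sets lebesgue" "emeasure lebesgue U < \<infinity>"
    and sub: "\<And>Q. Q \<in> layer S j \<Longrightarrow> Q \<subseteq> U"
    and c: "0 < c" "\<And>Q. Q \<in> layer S j \<Longrightarrow> c \<le> measure lebesgue Q"
  shows "finite (layer S j)"
proof -
  have "card F \<le> nat \<lfloor>measure lebesgue U / c\<rfloor>" if F: "F \<subseteq> layer S j" "finite F" for F
  proof -
    have FS: "F \<subseteq> S" using F(1) by (auto simp: layer_eq_depth)
    have "ennreal (card F * c) = (\<Sum>Q\<in>F. ennreal c)"
      using c(1) by (simp add: ennreal_mult ennreal_of_nat_eq_real_of_nat)
    also have "\<dots> \<le> (\<Sum>Q\<in>F. emeasure lebesgue Q)"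
    proof (rule sum_mono)
      fix Q assume "Q \<in> F"
      then have Q: "Q \<in> layer S j" "Q \<in> S" using F(1) FS by auto
      show "ennreal c \<le> emeasure lebesgue Q"
        using ennreal_leI[OF c(2)[OF Q(1)]] by (simp only: cube_measure(3)[OF Q(2)])
    qed
    also have "\<dots> = emeasure lebesgue (\<Union>Q\<in>F. Q)"
      using F FS cube_sets same_depth_disjoint
      by (intro sum_emeasure) (auto simp: disjoint_family_on_def layer_eq_depth subset_eq)
    also have "\<dots> \<le> emeasure lebesgue U"
      using sub F(1) U(1) by (intro emeasure_mono) auto
    also have "\<dots> = ennreal (measure lebesgue U)"
      using U by (intro emeasure_eq_ennreal_measure) auto
    finally have "card F * c \<le> measure lebesgue U" by simp
    then have "real (card F) \<le> measure lebesgue U / c" using c(1) by (simp add: field_simps)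
    then show ?thesis by (simp add: le_nat_floor)
  qed
  then show ?thesis using finite_if_finite_subsets_card_bdd[of "layer S j"] by blast
qed

text \<open>
  A cube of the next layer that meets \<open>E(Q)\<close> would be a proper subcube
  of \<open>Q\<close>, which \<open>E(Q)\<close> avoids by definition. Hence the next layer fits into what the sets \<open>E(Q)\<close>
  leave free, and these occupy a proportion \<open>\<eta>\<close> of the disjoint union of the layer.
\<close>

lemma region_decay:
  assumes sparse: "contracting_sparse \<eta> S"
    and fin: "finite (layer S j)" "finite (layer S (Suc j))"
  shows "measure lebesgue (region (Suc j)) \<le> (1 - \<eta>) * measure lebesgue (region j)"
proof -
  obtain E where E: "\<And>Q. Q \<in> S \<Longrightarrow> E Q \<in> sets lebesgue" "\<And>Q. Q \<in> S \<Longrightarrow> E Q \<subseteq> Q"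
    "\<And>Q. Q \<in> S \<Longrightarrow> \<eta> * measure lebesgue Q \<le> measure lebesgue (E Q)"
    "\<And>Q Q'. Q \<in> S \<Longrightarrow> Q' \<in> S \<Longrightarrow> Q' \<subset> Q \<Longrightarrow> E Q \<inter> Q' = {}"
    using sparse unfolding contracting_sparse_def by metis
  have S: "Q \<in> S" if "Q \<in> layer S i" for Q i using that by (auto simp: layer_eq_depth)
  have lm: "Q \<in> lmeasurable" if "Q \<in> S" for Q
    using cube_sets[OF that] cube_measure(3)[OF that] by (simp add: fmeasurable_def)
  have lmE: "E Q \<in> lmeasurable" if "Q \<in> S" for Q
    using fmeasurableI2[OF lm[OF that] E(2)[OF that] E(1)[OF that]] .
  let ?E = "\<Union>Q\<in>layer S j. E Q"
  have lmr: "region i \<in> lmeasurable" if "finite (layer S i)" for i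
    unfolding region_def using lm S that by (intro fmeasurable.finite_Union) auto
  have lmU: "?E \<in> lmeasurable"
    using lmE S fin by (intro fmeasurable.finite_UN) auto
  have disj: "Q \<inter> R = {}" if "Q \<in> layer S j" "R \<in> layer S j" "Q \<noteq> R" for Q R
    using same_depth_disjoint[of Q R] that by (auto simp: layer_eq_depth)
  have pw: "pairwise (\<lambda>Q R. disjnt Q R) (layer S j)"
    using disj by (simp add: pairwise_def disjnt_def)
  have pwE: "pairwise (\<lambda>Q R. disjnt (E Q) (E R)) (layer S j)"
    using disj E(2)[OF S] unfolding pairwise_def disjnt_def by blast
  have mr: "measure lebesgue (region j) = (\<Sum>Q\<in>layer S j. measure lebesgue Q)"
    using measure_UNION'[OF fin(1), of "\<lambda>Q. Q" lebesgue, OF lm[OF S] pw] by (simp add: region_def)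
  have "measure lebesgue ?E = (\<Sum>Q\<in>layer S j. measure lebesgue (E Q))"
    by (rule measure_UNION'[OF fin(1) lmE[OF S] pwE])
  also have "\<dots> \<ge> (\<Sum>Q\<in>layer S j. \<eta> * measure lebesgue Q)"
    using E(3) S by (intro sum_mono) auto
  finally have mE: "\<eta> * measure lebesgue (region j) \<le> measure lebesgue ?E"
    by (simp add: mr sum_distrib_left)
  have "region (Suc j) \<inter> E Q = {}" if Q: "Q \<in> layer S j" for Q
  proof (rule ccontr)
    assume "region (Suc j) \<inter> E Q \<noteq> {}"
    then obtain x R where x: "x \<in> E Q" "x \<in> R" "R \<in> S" "depth R = Suc j"
      by (auto simp: region_iff)
    have QS: "Q \<in> S" "depth Q = j" using Q by (auto simp: layer_eq_depth)
    have "\<not> Q \<subseteq> R" using depth_less[of Q R] QS x by (cases "Q = R") auto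
    then have "R \<subset> Q" using nested[of Q R] E(2) QS x by blast
    then show False using E(4)[of Q R] QS x by auto
  qed
  then have "region (Suc j) \<inter> ?E = {}" by auto
  then have "measure lebesgue (region (Suc j) \<union> ?E) =
      measure lebesgue (region (Suc j)) + measure lebesgue ?E"
    using measure_Un3[OF lmr[OF fin(2)] lmU] by simp
  moreover have "measure lebesgue (region (Suc j) \<union> ?E) \<le> measure lebesgue (region j)"
  proof (rule measure_mono_fmeasurable)
    show "region (Suc j) \<union> ?E \<subseteq> region j"
    proof (rule Un_least[OF region_Suc])
      show "?E \<subseteq> region j" unfolding region_def using E(2)[OF S] by blast
    qed
  qed (use lmr fin lmU in auto)
  ultimately show ?thesis using mE by (simp add: algebra_simps)
qed

end

section \<open>A geometric weight on the layers\<close>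

context cube_forest
begin

definition weight :: "real \<Rightarrow> real^'n \<Rightarrow> ennreal" where
  "weight b x = (\<Sum>j. indicator (region j) x * ennreal (b ^ j))"

end

text \<open>
  The quantitative content of being graded and sparse. For degree \<open>K\<close> the number \<open>\<rho>\<close> is
  \<open>2^(-nK)\<close>, and \<open>\<theta>\<close> is \<open>1 - \<eta>\<close>.
\<close>

locale graded_forest = cube_forest S for S :: "(real^'n) set set" +
  fixes \<theta> \<rho> :: real
  assumes theta: "0 < \<theta>" "\<theta> < 1" and rho: "0 < \<rho>" "\<rho> < 1"
    and finite_layers: "finite (layer S j)"
    and decay: "measure lebesgue (region j) \<le> \<theta> ^ j"
    and size: "Q \<in> S \<Longrightarrow> \<rho> ^ depth Q \<le> measure lebesgue Q"
begin

lemma countable_cubes: "countable S"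
proof -
  have "S = (\<Union>j. layer S j)" by (auto simp: layer_eq_depth)
  then show ?thesis using finite_layers by (metis countable_UN countable_finite countableI_type)
qed

lemma region_fmeasurable: "region j \<in> lmeasurable"
  unfolding region_def using finite_layers cube_sets cube_measure(3)
  by (intro fmeasurable.finite_Union) (auto simp: layer_eq_depth fmeasurable_def)

lemma region_sets [measurable]: "region j \<in> sets lebesgue"
  using region_fmeasurable by (simp add: fmeasurable_def)

lemma emeasure_region: "emeasure lebesgue (region j) \<le> ennreal (\<theta> ^ j)"
  using region_fmeasurable[of j] decay[of j]
  by (metis emeasure_eq_measure2 ennreal_leI)

lemma weight_outside:
  assumes "x \<notin> region k"
  shows "weight b x \<le> (\<Sum>j<k. ennreal (b ^ j))"
proof -
  have "x \<notin> region j" if "k \<le> j" for j using region_antimono[OF that] assms by auto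
  then have "weight b x = (\<Sum>j<k. indicator (region j) x * ennreal (b ^ j))"
    unfolding weight_def by (intro suminf_finite) auto
  also have "\<dots> \<le> (\<Sum>j<k. ennreal (b ^ j))"
    by (intro sum_mono) (auto split: split_indicator)
  finally show ?thesis .
qed

lemma weight_measurable [measurable]: "weight b \<in> borel_measurable lebesgue"
  unfolding weight_def by measurable

text \<open>
  Outside \<open>region (Suc k)\<close> only the first \<open>k + 1\<close> terms of the weight survive, and their sum is at
  most \<open>C b^k\<close> with \<open>C = b / (b - 1)\<close>. Choosing \<open>k\<close> by \<open>C b^k \<le> \<mu> < C b^(k+1)\<close> places the
  superlevel set inside \<open>region (Suc k)\<close>, whose measure decays as the power \<open>-1/s\<close> of \<open>b^(k+1)\<close>.
  For \<open>\<mu> < C\<close> the right-hand side exceeds the measure of \<open>region 0\<close>.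
\<close>

lemma weight_distribution:
  assumes b: "1 < b" and s: "0 < s" "b powr (- 1 / s) = \<theta>" and \<mu>: "0 < \<mu>"
  shows "emeasure lebesgue {x. weight b x > ennreal \<mu>}
    \<le> ennreal ((b / (b - 1) / \<mu>) powr (1 / s))"
proof -
  define C where "C = b / (b - 1)"
  have C: "1 < C" using b by (simp add: C_def field_simps)
  show ?thesis
  proof (cases "\<mu> < C")
    case True
    have "{x. weight b x > ennreal \<mu>} \<subseteq> region 0"
      using weight_outside[of _ 0 b] \<mu> by (force simp: not_le[symmetric])
    then have "emeasure lebesgue {x. weight b x > ennreal \<mu>} \<le> emeasure lebesgue (region 0)"
      by (intro emeasure_mono region_sets)
    also have "\<dots> \<le> ennreal 1" using emeasure_region[of 0] by simp
    also have "\<dots> \<le> ennreal ((C / \<mu>) powr (1 / s))"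
      using True \<mu> s by (intro ennreal_leI ge_one_powr_ge_zero) auto
    finally show ?thesis by (simp add: C_def)
  next
    case False
    define n where "n = (LEAST n. \<mu> / C < b ^ n)"
    have n: "\<mu> / C < b ^ n"
      unfolding n_def using real_arch_pow[OF b, of "\<mu> / C"] by (auto intro: LeastI)
    have "n \<noteq> 0" using n False C by (auto simp: field_simps intro: ccontr)
    then obtain k where k: "n = Suc k" by (cases n) auto
    have "\<not> \<mu> / C < b ^ k" using not_less_Least[of k "\<lambda>n. \<mu> / C < b ^ n"] k by (simp add: n_def)
    then have k1: "C * b ^ k \<le> \<mu>" using C by (simp add: field_simps)
    have "(\<Sum>j<Suc k. b ^ j) = (b ^ Suc k - 1) / (b - 1)"
      using b by (subst sum_gp_strict) (simp add: field_simps)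
    also have "\<dots> \<le> C * b ^ k" using b by (simp add: C_def divide_right_mono)
    finally have sum: "(\<Sum>j<Suc k. b ^ j) \<le> \<mu>" using k1 by linarith
    have "{x. weight b x > ennreal \<mu>} \<subseteq> region (Suc k)"
    proof (rule subsetI, rule ccontr)
      fix x assume x: "x \<in> {x. weight b x > ennreal \<mu>}" "x \<notin> region (Suc k)"
      have "weight b x \<le> (\<Sum>j<Suc k. ennreal (b ^ j))" by (rule weight_outside[OF x(2)])
      also have "\<dots> = ennreal (\<Sum>j<Suc k. b ^ j)" using b by (intro sum_ennreal) auto
      also have "\<dots> \<le> ennreal \<mu>" using sum by (rule ennreal_leI)
      finally show False using x(1) by auto
    qed
    then have "emeasure lebesgue {x. weight b x > ennreal \<mu>} \<le> emeasure lebesgue (region (Suc k))"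
      by (intro emeasure_mono region_sets)
    also have "\<dots> \<le> ennreal (\<theta> ^ Suc k)" by (rule emeasure_region)
    also have "\<theta> ^ Suc k = (b ^ Suc k) powr (- 1 / s)"
      using b by (simp add: s(2)[symmetric] powr_powr powr_realpow[symmetric] mult.commute del: power_Suc)
    also have "\<dots> \<le> (\<mu> / C) powr (- 1 / s)"
      using n k C \<mu> s by (intro powr_mono2') auto
    also have "\<dots> = (C / \<mu>) powr (1 / s)"
      using C \<mu> by (simp add: powr_minus powr_divide divide_simps)
    finally show ?thesis by (simp add: C_def ennreal_leI)
  qed
qed

end

section \<open>Lebesgue and weak Lebesgue norms\<close>

lemma power_powr_swap: "0 < (x::real) \<Longrightarrow> (x ^ n) powr q = (x powr q) ^ n"
  by (induction n) (simp_all add: powr_mult)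

text \<open>
  The embedding of weak \<open>L^r\<close> into \<open>L^q\<close> on a support of measure at most \<open>1\<close>, by decomposing the values
  dyadically above the threshold \<open>N\<close>: the part where the function is between \<open>2^k N\<close> and \<open>2^(k+1) N\<close>
  contributes a constant times \<open>2^(k(q-r))\<close>, which is summable for \<open>q < r\<close>.
\<close>

lemma nn_integral_epowr_le:
  assumes [measurable]: "G \<in> borel_measurable M"
    and q: "0 < q" "q < r" and N: "0 < N" and B: "0 \<le> B"
    and supp: "emeasure M {x \<in> space M. G x > 0} \<le> 1"
    and distr: "\<And>l. 0 < l \<Longrightarrow> emeasure M {x \<in> space M. G x > ennreal l} \<le> ennreal (B * (N / l) powr r)"
  shows "(\<integral>\<^sup>+x. epowr (G x) q \<partial>M)
    \<le> ennreal (N powr q * (1 + B * 2 powr q / (1 - 2 powr (q - r))))"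
proof -
  define H where "H k = {x \<in> space M. G x > ennreal (2 ^ k * N)}" for k :: nat
  define c where "c k = (2 ^ Suc k * N) powr q" for k :: nat
  have c_eq: "c k = N powr q * 2 powr q * (2 powr q) ^ k" for k
    using N power_powr_swap[of 2 "Suc k" q] by (simp only: c_def powr_mult power_Suc mult_ac)
  have [measurable]: "H k \<in> sets M" for k unfolding H_def by measurable
  define P where "P = {x \<in> space M. G x > 0}"
  have [measurable]: "P \<in> sets M" unfolding P_def by measurable
  have single: "ennreal (c k) \<le> (\<Sum>k. ennreal (c k) * indicator (H k) x)" if "x \<in> H k" for k x
    using sum_le_suminf[of "\<lambda>k. ennreal (c k) * indicator (H k) x" "{k}"] that by simp
  have pw: "epowr (G x) q \<le> ennreal (N powr q) * indicator P x
      + (\<Sum>k. ennreal (c k) * indicator (H k) x)" if x: "x \<in> space M" for x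
  proof (cases "G x")
    case top
    \<comment> \<open>At an infinite value all terms of the series are present, and they are unbounded.\<close>
    have "(\<Sum>k. ennreal (c k) * indicator (H k) x) = top"
    proof (rule ccontr)
      assume "\<not> ?thesis"
      then obtain v where v: "0 \<le> v" "(\<Sum>k. ennreal (c k) * indicator (H k) x) = ennreal v"
        by (cases "\<Sum>k. ennreal (c k) * indicator (H k) x") auto
      have "1 < (2::real) powr q" using q(1) by simp
      then obtain k where k: "v / N powr q < (2 powr q) ^ k" using real_arch_pow by blast
      have "(2 powr q) ^ k * N powr q \<le> c k"
      proof -
        have "1 * ((2 powr q) ^ k * N powr q) \<le> 2 powr q * ((2 powr q) ^ k * N powr q)"
          using \<open>1 < 2 powr q\<close> by (intro mult_right_mono) auto
        also have "\<dots> = c k" by (simp only: c_eq mult_ac)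
        finally show ?thesis by simp
      qed
      moreover have "c k \<le> v" using single[of x k] v x top by (simp add: H_def)
      ultimately show False using k N by (simp add: field_simps)
    qed
    then show ?thesis by simp
  next
    case (real g)
    consider "g = 0" | "0 < g" "g \<le> N" | "N < g" using real by linarith
    then show ?thesis
    proof cases
      case 1 then show ?thesis using real by (simp add: epowr_def)
    next
      case 2
      then have "epowr (G x) q \<le> ennreal (N powr q) * indicator P x"
        using real x q(1) by (auto simp: epowr_def P_def intro!: ennreal_leI powr_mono2)
      then show ?thesis by (rule order_trans) simp
    next
      case 3
      define n where "n = (LEAST n. g / N \<le> 2 ^ n)"
      have n: "g / N \<le> 2 ^ n"
        unfolding n_def using real_arch_pow[of 2 "g / N"] by (auto intro: LeastI less_imp_le)
      have "n \<noteq> 0" using n 3 N by (auto simp: field_simps intro: ccontr)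
      then obtain k where k: "n = Suc k" by (cases n) auto
      have "\<not> g / N \<le> 2 ^ k"
        using not_less_Least[of k "\<lambda>n. g / N \<le> 2 ^ n"] k by (simp add: n_def)
      then have xk: "x \<in> H k"
        using N x real by (simp add: H_def field_simps ennreal_less_iff)
      have "epowr (G x) q \<le> ennreal (c k)"
        using n k N q(1) real by (auto simp: epowr_def c_def field_simps intro!: ennreal_leI powr_mono2)
      also note single[OF xk]
      finally show ?thesis by (rule order_trans) simp
    qed
  qed
  define a where "a k = N powr q * B * 2 powr q * (2 powr (q - r)) ^ k" for k :: nat
  have ratio: "(2::real) powr (q - r) < 1" using q(2) powr_less_mono[of "q - r" 0 2] by simp
  have a_sums: "a sums (N powr q * B * 2 powr q * (1 / (1 - 2 powr (q - r))))"
    unfolding a_def using ratio by (intro sums_mult geometric_sums) simp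
  have ak: "ennreal (c k) * emeasure M (H k) \<le> ennreal (a k)" for k
  proof -
    have "ennreal (c k) * emeasure M (H k)
        \<le> ennreal (c k) * ennreal (B * (N / (2 ^ k * N)) powr r)"
      unfolding H_def using N by (intro mult_left_mono distr) auto
    also have "\<dots> = ennreal (c k * (B * (N / (2 ^ k * N)) powr r))"
      using B by (subst ennreal_mult) (auto simp: c_def)
    also have "c k * (B * (N / (2 ^ k * N)) powr r) = a k"
      using N by (simp add: c_eq a_def powr_divide power_powr_swap powr_diff power_divide)
    finally show ?thesis .
  qed
  have "(\<integral>\<^sup>+x. epowr (G x) q \<partial>M) \<le> (\<integral>\<^sup>+x. ennreal (N powr q) * indicator P x
      + (\<Sum>k. ennreal (c k) * indicator (H k) x) \<partial>M)"
    by (intro nn_integral_mono pw)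
  also have "\<dots> = ennreal (N powr q) * emeasure M P + (\<Sum>k. ennreal (c k) * emeasure M (H k))"
    by (simp add: nn_integral_add nn_integral_suminf nn_integral_cmult_indicator)
  also have "\<dots> \<le> ennreal (N powr q) * 1 + (\<Sum>k. ennreal (a k))"
    using supp by (intro add_mono mult_left_mono suminf_le ak) (auto simp: P_def)
  also have "(\<Sum>k. ennreal (a k)) = ennreal (N powr q * B * 2 powr q * (1 / (1 - 2 powr (q - r))))"
    using sums_unique[OF a_sums] a_sums B
    by (subst suminf_ennreal2) (auto simp: sums_iff a_def)
  also have "ennreal (N powr q) * 1 + \<dots>
      = ennreal (N powr q + N powr q * B * 2 powr q * (1 / (1 - 2 powr (q - r))))"
    using B ratio by (subst ennreal_plus) auto
  also have "N powr q + N powr q * B * 2 powr q * (1 / (1 - 2 powr (q - r)))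
      = N powr q * (1 + B * 2 powr q / (1 - 2 powr (q - r)))"
    by (simp add: algebra_simps)
  finally show ?thesis .
qed

lemma enn2real_one_divide:
  assumes "1 \<le> q" "q \<noteq> top"
  shows "enn2real (1 / q) = 1 / enn2real q"
  using assms divide_ennreal[of 1 "enn2real q"] by (cases q) auto

lemma L_norm_top_le:
  assumes "L_norm top g \<le> c"
  shows "AE x in lebesgue. g x \<le> c"
  using esssup_AE[of g lebesgue] assms by (auto simp: L_norm_def elim!: eventually_mono)

text \<open>
  Together with \<open>L_norm_leI\<close> this translates between the norm and the integral of the \<open>p\<close>-th power, away
  from \<open>p = \<infinity>\<close>.
\<close>

lemma L_norm_leD:
  assumes "1 \<le> p" "p \<noteq> top" "0 \<le> N" "L_norm p g \<le> ennreal N"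
  shows "(\<integral>\<^sup>+x. epowr (g x) (enn2real p) \<partial>lebesgue) \<le> ennreal (N powr enn2real p)"
proof -
  define P where "P = enn2real p"
  have P: "1 \<le> P" using assms(1,2) by (cases p) (auto simp: P_def)
  let ?X = "\<integral>\<^sup>+x. epowr (g x) P \<partial>lebesgue"
  have *: "epowr ?X (1 / P) \<le> ennreal N"
    using assms enn2real_one_divide[of p] by (simp add: L_norm_def P_def)
  show ?thesis
  proof (cases ?X)
    case top
    then show ?thesis using * P by (simp add: epowr_def top_unique)
  next
    case (real \<xi>)
    then have "\<xi> powr (1 / P) \<le> N" using * assms(3) by (simp add: epowr_def)
    then have "(\<xi> powr (1 / P)) powr P \<le> N powr P" using P by (intro powr_mono2) auto
    then show ?thesis using real P by (simp add: powr_powr P_def[symmetric] ennreal_leI)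
  qed
qed

lemma L_norm_leI:
  assumes "1 \<le> q" "q \<noteq> top" "0 \<le> N" "0 \<le> c"
    "(\<integral>\<^sup>+x. epowr (g x) (enn2real q) \<partial>lebesgue) \<le> ennreal (N powr enn2real q * c)"
  shows "L_norm q g \<le> ennreal (c powr (1 / enn2real q) * N)"
proof -
  define P where "P = enn2real q"
  have P: "1 \<le> P" using assms(1,2) by (cases q) (auto simp: P_def)
  let ?X = "\<integral>\<^sup>+x. epowr (g x) P \<partial>lebesgue"
  obtain \<xi> where \<xi>: "0 \<le> \<xi>" "?X = ennreal \<xi>"
    using assms(5) by (cases ?X) (auto simp: P_def top_unique)
  have "\<xi> \<le> N powr P * c" using assms(3-5) \<xi> by (simp add: P_def)
  then have "\<xi> powr (1 / P) \<le> (N powr P * c) powr (1 / P)"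
    using \<xi> P by (intro powr_mono2) auto
  also have "\<dots> = c powr (1 / P) * N"
    using assms(3,4) P by (simp add: powr_mult powr_powr)
  finally show ?thesis
    using assms(2) \<xi> enn2real_one_divide[OF assms(1,2)]
    by (simp add: L_norm_def P_def[symmetric] epowr_def ennreal_leI)
qed

lemma weak_L_norm_leI:
  assumes r: "0 < r" "enn2real (1 / q) = 1 / r" and N: "0 < N" and B: "0 \<le> B"
    and distr: "\<And>l. 0 < l \<Longrightarrow> emeasure lebesgue {x. g x > ennreal l} \<le> ennreal (B * (N / l) powr r)"
  shows "weak_L_norm q g \<le> ennreal (B powr (1 / r) * N)"
  unfolding weak_L_norm_def
proof (rule SUP_least)
  fix l :: real assume "l \<in> {0<..}"
  then have l: "0 < l" by simp
  let ?m = "emeasure lebesgue {x. g x > ennreal l}"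
  obtain m where m: "0 \<le> m" "?m = ennreal m" "m \<le> B * (N / l) powr r"
    using distr[OF l] B by (cases ?m) (auto simp: top_unique)
  have "m powr (1 / r) \<le> (B * (N / l) powr r) powr (1 / r)"
    using m r by (intro powr_mono2) auto
  also have "\<dots> = B powr (1 / r) * (N / l)"
    using B N l r by (simp add: powr_mult powr_powr)
  finally have "l * m powr (1 / r) \<le> B powr (1 / r) * N"
    using l by (simp add: field_simps)
  then show "ennreal l * epowr ?m (enn2real (1 / q)) \<le> ennreal (B powr (1 / r) * N)"
    using m l r by (simp add: epowr_def ennreal_mult[symmetric] ennreal_leI)
qed

text \<open>
  It suffices to bound the operator by every positive real that dominates the norm of \<open>f\<close>; a norm
  that vanishes is then reached in the limit.
\<close>

lemma bounded_from_L_I: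
  fixes T :: "(real^'n \<Rightarrow> complex) \<Rightarrow> real^'n \<Rightarrow> ennreal"
  assumes C: "0 \<le> C"
    and meas: "\<And>f. f \<in> borel_measurable lebesgue \<Longrightarrow> T f \<in> borel_measurable lebesgue"
    and bound: "\<And>f N. f \<in> borel_measurable lebesgue \<Longrightarrow> 0 < N \<Longrightarrow>
      L_norm p (\<lambda>x. ennreal (norm (f x))) \<le> ennreal N \<Longrightarrow> Norm (T f) \<le> ennreal (C * N)"
  shows "bounded_from_L p Norm T"
  unfolding bounded_from_L_def
proof (intro exI[of _ C] ballI impI conjI meas)
  fix f :: "real^'n \<Rightarrow> complex"
  assume f: "f \<in> borel_measurable lebesgue" "L_norm p (\<lambda>x. ennreal (norm (f x))) < top"
  obtain n where n: "0 \<le> n" "L_norm p (\<lambda>x. ennreal (norm (f x))) = ennreal n"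
    using f(2) by (cases "L_norm p (\<lambda>x. ennreal (norm (f x)))") auto
  have eps: "Norm (T f) \<le> ennreal (C * n) + ennreal e" if e: "0 < e" for e
  proof -
    define d where "d = e / (C + 1)"
    have d: "0 < d" "C * d \<le> e" using e C by (auto simp: d_def field_simps)
    have "Norm (T f) \<le> ennreal (C * (n + d))"
      using n d(1) by (intro bound f(1)) (auto intro!: ennreal_leI)
    also have "\<dots> \<le> ennreal (C * n + e)" using d by (intro ennreal_leI) (simp add: algebra_simps)
    also have "\<dots> = ennreal (C * n) + ennreal e" using C n e by (subst ennreal_plus) auto
    finally show ?thesis .
  qed
  have "Norm (T f) \<le> ennreal (C * n)" by (rule ennreal_le_epsilon) (rule eps)
  then show "Norm (T f) \<le> ennreal C * L_norm p (\<lambda>x. ennreal (norm (f x)))"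
    using n C by (simp add: ennreal_mult)
qed

section \<open>The maximal function of a forest\<close>

lemma superlevel_set_measurable:
  fixes g :: "'a::euclidean_space \<Rightarrow> ennreal"
  assumes "g \<in> borel_measurable lebesgue"
  shows "{x. c < g x} \<in> sets lebesgue"
  using measurable_sets[OF assms, of "{c<..}"] by (simp add: vimage_def)

context cube_forest
begin

definition avg :: "(real^'n \<Rightarrow> ennreal) \<Rightarrow> (real^'n) set \<Rightarrow> ennreal" where
  "avg g Q = (\<integral>\<^sup>+y\<in>Q. g y \<partial>lebesgue) / emeasure lebesgue Q"

definition maxfun :: "(real^'n \<Rightarrow> ennreal) \<Rightarrow> real^'n \<Rightarrow> ennreal" where
  "maxfun g x = (SUP Q\<in>{Q \<in> S. x \<in> Q}. avg g Q)"

end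

context graded_forest
begin

lemma avg_le_const:
  assumes "Q \<in> S" "0 \<le> N" "AE x in lebesgue. g x \<le> ennreal N"
  shows "avg g Q \<le> ennreal N"
proof -
  note m = cube_measure(3,4)[OF assms(1)]
  have "(\<integral>\<^sup>+y\<in>Q. g y \<partial>lebesgue) \<le> (\<integral>\<^sup>+y\<in>Q. ennreal N \<partial>lebesgue)"
    using assms(3) by (intro nn_integral_mono_AE) (auto elim!: eventually_mono split: split_indicator)
  also have "\<dots> = ennreal N * ennreal (measure lebesgue Q)"
    using cube_sets[OF assms(1)] by (simp only: nn_integral_cmult_indicator m(1))
  finally have "avg g Q \<le> ennreal N * ennreal (measure lebesgue Q) / ennreal (measure lebesgue Q)"
    unfolding avg_def m(1) by (rule divide_right_mono_ennreal)
  also have "\<dots> = ennreal N" using m(2) by (intro mult_divide_eq_ennreal) auto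
  finally show ?thesis .
qed

lemma maxfun_le_const:
  assumes "0 \<le> N" "AE x in lebesgue. g x \<le> ennreal N"
  shows "maxfun g x \<le> ennreal N"
  unfolding maxfun_def using avg_le_const[OF _ assms] by (intro SUP_least) auto

text \<open>
  A substitute for Hoelder's inequality on \<open>Q\<close>. Cutting \<open>h\<close> at height \<open>l/2\<close> gives
  \<open>h \<le> l/2 + (2/l)^(p-1) h^p\<close> pointwise. If the mean of \<open>h\<close> exceeds \<open>l\<close>, the constant accounts for at
  most half of it, so the second term controls \<open>|Q|\<close>.
\<close>

lemma measure_le_of_large_avg:
  assumes Q: "Q \<in> S" and h: "h \<in> borel_measurable lebesgue" "\<And>y. 0 \<le> h y"
    and p: "1 \<le> p" and l: "0 < l" and large: "ennreal l < avg (\<lambda>y. ennreal (h y)) Q"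
  shows "emeasure lebesgue Q \<le> ennreal ((2 / l) powr p) * (\<integral>\<^sup>+y\<in>Q. ennreal (h y powr p) \<partial>lebesgue)"
proof -
  have [measurable]: "h \<in> borel_measurable lebesgue" "Q \<in> sets lebesgue"
    using h(1) cube_sets[OF Q] by auto
  define m where "m = measure lebesgue Q"
  have m: "emeasure lebesgue Q = ennreal m" "0 < m" using cube_measure(3,4)[OF Q] by (auto simp: m_def)
  define I where "I = (\<integral>\<^sup>+y\<in>Q. ennreal (h y) \<partial>lebesgue)"
  define J where "J = (\<integral>\<^sup>+y\<in>Q. ennreal (h y powr p) \<partial>lebesgue)"
  define c where "c = (2 / l) powr (p - 1)"
  have c: "0 < c" using l by (simp add: c_def)
  have cl: "c * (2 / l) = (2 / l) powr p" using l by (simp add: c_def powr_diff)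
  have trunc: "h y \<le> l / 2 + c * h y powr p" for y
  proof (cases "h y \<le> l / 2")
    case True then show ?thesis using c by (simp add: add_increasing2)
  next
    case False
    then have hy: "0 < h y" "1 \<le> 2 / l * h y" using l by (auto simp: field_simps)
    have "h y * 1 \<le> h y * (2 / l * h y) powr (p - 1)"
      using hy p by (intro mult_left_mono ge_one_powr_ge_zero) auto
    also have "\<dots> = c * h y powr p"
    proof -
      have "(2 / l * h y) powr (p - 1) = c * h y powr (p - 1)"
        unfolding c_def by (rule powr_mult)
      then show ?thesis using hy(1) powr_mult_base[of "h y" "p - 1"] by (simp add: mult_ac)
    qed
    finally show ?thesis using l by simp
  qed
  have "I \<le> (\<integral>\<^sup>+y. ennreal (l / 2) * indicator Q y + ennreal c * (ennreal (h y powr p) * indicator Q y) \<partial>lebesgue)"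
    unfolding I_def
  proof (rule nn_integral_mono)
    fix y
    have "ennreal (h y) \<le> ennreal (l / 2 + c * h y powr p)" by (rule ennreal_leI[OF trunc])
    also have "\<dots> = ennreal (l / 2) + ennreal c * ennreal (h y powr p)"
      using l c by (simp add: ennreal_mult)
    finally show "ennreal (h y) * indicator Q y
        \<le> ennreal (l / 2) * indicator Q y + ennreal c * (ennreal (h y powr p) * indicator Q y)"
      by (simp split: split_indicator)
  qed
  also have "\<dots> = ennreal (l / 2) * ennreal m + ennreal c * J"
    unfolding J_def m(1)[symmetric] by (subst nn_integral_add)
      (auto simp: nn_integral_cmult nn_integral_cmult_indicator simp del: emeasure_completion)
  finally have up: "I \<le> ennreal (l / 2) * ennreal m + ennreal c * J" .
  have low: "ennreal l * ennreal m \<le> I"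
  proof (rule ccontr)
    assume "\<not> ?thesis"
    then have "I / ennreal m \<le> ennreal l * ennreal m / ennreal m"
      by (intro divide_right_mono_ennreal) auto
    also have "\<dots> = ennreal l" using m(2) by (intro mult_divide_eq_ennreal) auto
    finally show False using large by (simp add: avg_def I_def m(1) del: emeasure_completion)
  qed
  have "ennreal m \<le> ennreal ((2 / l) powr p) * J"
  proof (cases J)
    case top then show ?thesis using l by (simp add: ennreal_mult_top)
  next
    case (real j)
    have "ennreal (l * m) \<le> ennreal (l / 2 * m + c * j)"
    proof -
      have "ennreal (l * m) \<le> ennreal (l / 2) * ennreal m + ennreal c * ennreal j"
        using order_trans[OF low up] real l m(2) ennreal_mult[of l m] by simp
      also have "\<dots> = ennreal (l / 2 * m) + ennreal (c * j)"
        using real l m(2) c ennreal_mult[of "l / 2" m] ennreal_mult[of c j] by simp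
      also have "\<dots> = ennreal (l / 2 * m + c * j)"
        using real l m(2) c ennreal_plus[of "l / 2 * m" "c * j"] by simp
      finally show ?thesis .
    qed
    then have "l * m \<le> l / 2 * m + c * j" using l m(2) c real by (subst (asm) ennreal_le_iff) auto
    then have "m \<le> c * (2 / l) * j" using l by (simp add: field_simps)
    then have "m \<le> (2 / l) powr p * j" by (simp only: cl)
    then show ?thesis using real by (simp add: ennreal_mult[symmetric] ennreal_leI)
  qed
  then show ?thesis by (simp only: m(1) J_def)
qed

text \<open>
  The superlevel set is the union of the cubes with large mean, hence of the maximal ones among them.
  These are disjoint, so the bounds on the individual cubes add up to the integral of \<open>h^p\<close>.
\<close>

lemma maxfun_weak_type:
  assumes h: "h \<in> borel_measurable lebesgue" "\<And>y. 0 \<le> h y"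
    and p: "1 \<le> p" and l: "0 < l"
  shows "emeasure lebesgue {x. maxfun (\<lambda>y. ennreal (h y)) x > ennreal l}
    \<le> ennreal ((2 / l) powr p) * (\<integral>\<^sup>+y. ennreal (h y powr p) \<partial>lebesgue)"
proof -
  let ?g = "\<lambda>y. ennreal (h y)"
  let ?G = "\<lambda>y. ennreal ((2 / l) powr p) * ennreal (h y powr p)"
  have [measurable]: "h \<in> borel_measurable lebesgue" by (rule h)
  let ?B = "{Q \<in> S. ennreal l < avg ?g Q}"
  let ?M = "maximal_cubes ?B"
  have MB: "?M \<subseteq> ?B" by (auto simp: maximal_cubes_def)
  have "{x. maxfun ?g x > ennreal l} = (\<Union>Q\<in>?M. Q)"
  proof (intro equalityI subsetI)
    fix x assume "x \<in> {x. maxfun ?g x > ennreal l}"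
    then obtain Q where Q: "Q \<in> ?B" "x \<in> Q" by (auto simp: maxfun_def less_SUP_iff)
    obtain R where "R \<in> ?M" "Q \<subseteq> R" using below_maximal[of ?B Q] Q(1) by auto
    then show "x \<in> (\<Union>Q\<in>?M. Q)" using Q(2) by auto
  qed (use MB in \<open>auto simp: maxfun_def less_SUP_iff\<close>)
  also have "emeasure lebesgue \<dots> = (\<integral>\<^sup>+Q. emeasure lebesgue Q \<partial>count_space ?M)"
    using MB cube_sets countable_subset[OF _ countable_cubes, of ?M] disjoint_maximal[of ?B]
    by (intro emeasure_UN_countable) auto
  \<comment> \<open>Reading the integrals over cubes as the measure with density \<open>(2/l)^p h^p\<close> makes their summation countable additivity.\<close>
  also have "\<dots> \<le> (\<integral>\<^sup>+Q. emeasure (density lebesgue ?G) Q \<partial>count_space ?M)"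
  proof (rule nn_integral_mono)
    fix Q assume "Q \<in> space (count_space ?M)"
    then have Q: "Q \<in> S" "ennreal l < avg ?g Q" using MB by auto
    have [measurable]: "Q \<in> sets lebesgue" by (rule cube_sets[OF Q(1)])
    have "emeasure (density lebesgue ?G) Q
        = ennreal ((2 / l) powr p) * (\<integral>\<^sup>+y\<in>Q. ennreal (h y powr p) \<partial>lebesgue)"
      by (simp add: emeasure_density nn_integral_cmult[symmetric] mult.assoc)
    then show "emeasure lebesgue Q \<le> emeasure (density lebesgue ?G) Q"
      using measure_le_of_large_avg[OF Q(1) h p l Q(2)] by (simp only:)
  qed
  also have "\<dots> = emeasure (density lebesgue ?G) (\<Union>Q\<in>?M. Q)"
    using MB cube_sets countable_subset[OF _ countable_cubes, of ?M] disjoint_maximal[of ?B]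
    by (intro emeasure_UN_countable[symmetric]) auto
  also have "\<dots> \<le> emeasure (density lebesgue ?G) (space (density lebesgue ?G))"
    by (rule emeasure_space)
  also have "\<dots> = ennreal ((2 / l) powr p) * (\<integral>\<^sup>+y. ennreal (h y powr p) \<partial>lebesgue)"
    by (simp add: emeasure_density nn_integral_cmult)
  finally show ?thesis .
qed

lemma maxfun_measurable [measurable]: "maxfun g \<in> borel_measurable lebesgue"
proof -
  have "maxfun g x = (SUP Q\<in>S. indicator Q x * avg g Q)" for x
    unfolding maxfun_def by (intro antisym SUP_least) (auto intro!: SUP_upper2 split: split_indicator)
  then show ?thesis
    using cube_sets countable_cubes
    by (auto intro!: borel_measurable_SUP borel_measurable_times_ennreal borel_measurable_indicator
      simp: fun_eq_iff[symmetric] cong: measurable_cong)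
qed

section \<open>Distribution of the sparse operator\<close>

lemma sparse_op_measurable:
  assumes "f \<in> borel_measurable lebesgue"
  shows "sparse_op S t f \<in> borel_measurable lebesgue"
proof -
  have "(\<lambda>x. SUP F\<in>{F. finite F \<and> F \<subseteq> S}. \<Sum>Q\<in>F. indicator Q x / ennreal (measure lebesgue Q powr t) *
        (\<integral>\<^sup>+y\<in>Q. ennreal (norm (f y)) \<partial>lebesgue)) \<in> borel_measurable lebesgue"
    using cube_sets
    by (intro borel_measurable_SUP countable_Collect_finite_subset countable_cubes
        borel_measurable_sum borel_measurable_times_ennreal borel_measurable_divide_ennreal
        borel_measurable_indicator) auto
  then show ?thesis
    unfolding sparse_op_def[abs_def] by (subst nonneg_infsum_complete) auto
qed

text \<open>
  Each term of the operator at \<open>x\<close> is \<open>|Q|^(1-t)\<close> times a mean value. The mean is at most the maximal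
  function, and the factor is at most \<open>\<rho>^(j(1-t))\<close> for a cube of depth \<open>j\<close>, because \<open>1 - t\<close> is negative. As cubes
  of equal depth are disjoint, those that contain \<open>x\<close> have distinct depths, and their factors are
  distinct terms of the weight.
\<close>

lemma sparse_op_le:
  assumes t: "1 < t"
  shows "sparse_op S t f x \<le> weight (\<rho> powr (1 - t)) x * maxfun (\<lambda>y. ennreal (norm (f y))) x"
proof -
  let ?g = "\<lambda>y. ennreal (norm (f y))"
  let ?b = "\<rho> powr (1 - t)"
  let ?I = "\<lambda>Q. \<integral>\<^sup>+y\<in>Q. ?g y \<partial>lebesgue"
  let ?T = "\<lambda>Q. indicator Q x / ennreal (measure lebesgue Q powr t) * ?I Q"
  have "sum ?T F \<le> weight ?b x * maxfun ?g x" if F: "finite F" "F \<subseteq> S" for F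
  proof -
    let ?F = "{Q \<in> F. x \<in> Q}"
    have inj: "inj_on depth ?F"
      using same_depth_disjoint F(2) by (intro inj_onI) blast
    have "sum ?T F = sum ?T ?F"
      using F(1) by (intro sum.mono_neutral_right) auto
    also have "\<dots> \<le> (\<Sum>Q\<in>?F. ennreal (?b ^ depth Q) * maxfun ?g x)"
    proof (rule sum_mono)
      fix Q assume "Q \<in> ?F"
      then have Q: "Q \<in> S" "x \<in> Q" using F(2) by auto
      define m where "m = measure lebesgue Q"
      have m: "emeasure lebesgue Q = ennreal m" "0 < m" "\<rho> ^ depth Q \<le> m"
        using cube_measure(3,4)[OF Q(1)] size[OF Q(1)] by (auto simp: m_def)
      have "?T Q = ennreal (1 / m powr t) * ?I Q"
        using Q(2) m(2) divide_ennreal[of 1 "m powr t"] by (simp add: m_def[symmetric])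
      also have "1 / m powr t = m powr (1 - t) * (1 / m)"
        using m(2) by (simp add: powr_diff)
      also have "ennreal (m powr (1 - t) * (1 / m)) * ?I Q = ennreal (m powr (1 - t)) * avg ?g Q"
      proof -
        have "ennreal (m powr (1 - t) * (1 / m)) = ennreal (m powr (1 - t)) * inverse (ennreal m)"
          using m(2) by (simp only: inverse_ennreal inverse_eq_divide ennreal_mult' powr_ge_zero)
        then show ?thesis
          by (simp only: avg_def m(1) divide_ennreal_def mult_ac)
      qed
      also have "\<dots> \<le> ennreal (?b ^ depth Q) * maxfun ?g x"
      proof (intro mult_mono ennreal_leI)
        have "m powr (1 - t) \<le> (\<rho> ^ depth Q) powr (1 - t)"
          using m(2,3) t rho by (intro powr_mono2') auto
        also have "\<dots> = ?b ^ depth Q" using rho by (simp add: power_powr_swap)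
        finally show "m powr (1 - t) \<le> ?b ^ depth Q" .
        show "avg ?g Q \<le> maxfun ?g x"
          unfolding maxfun_def using Q by (intro SUP_upper) auto
      qed auto
      finally show "?T Q \<le> ennreal (?b ^ depth Q) * maxfun ?g x" .
    qed
    also have "\<dots> = (\<Sum>Q\<in>?F. ennreal (?b ^ depth Q)) * maxfun ?g x"
      by (rule sum_distrib_right[symmetric])
    also have "(\<Sum>Q\<in>?F. ennreal (?b ^ depth Q))
        = (\<Sum>Q\<in>?F. indicator (region (depth Q)) x * ennreal (?b ^ depth Q))"
      using F(2) by (intro sum.cong) (auto simp: region_iff split: split_indicator)
    also have "\<dots> = (\<Sum>j\<in>depth ` ?F. indicator (region j) x * ennreal (?b ^ j))"
      by (simp add: sum.reindex[OF inj])
    also have "\<dots> * maxfun ?g x \<le> weight ?b x * maxfun ?g x"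
      unfolding weight_def using F(1)
      by (intro mult_right_mono sum_le_suminf summableI) auto
    finally show ?thesis by (auto intro: mult_right_mono)
  qed
  then show ?thesis
    unfolding sparse_op_def by (subst nonneg_infsum_complete) (auto intro!: SUP_least)
qed

lemma sparse_op_support:
  assumes "1 < t"
  shows "emeasure lebesgue {x. sparse_op S t f x > 0} \<le> 1"
proof -
  have "{x. sparse_op S t f x > 0} \<subseteq> region 0"
  proof (rule subsetI, rule ccontr)
    fix x assume x: "x \<in> {x. sparse_op S t f x > 0}" "x \<notin> region 0"
    then show False
      using sparse_op_le[OF assms, of f x] weight_outside[OF x(2), of "\<rho> powr (1 - t)"] by simp
  qed
  then have "emeasure lebesgue {x. sparse_op S t f x > 0} \<le> emeasure lebesgue (region 0)"
    by (intro emeasure_mono region_sets)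
  also have "\<dots> \<le> 1" using emeasure_region[of 0] by simp
  finally show ?thesis .
qed

text \<open>
  Hoelder's inequality for weak spaces, applied to \<open>w \<cdot> M f\<close>: where the product exceeds \<open>l\<close>, either \<open>w\<close>
  exceeds \<open>\<mu>\<close> or \<open>M f\<close> exceeds \<open>l/\<mu>\<close>. For finite \<open>p\<close> the choice \<open>\<mu> = (l/N)^e\<close> with
  \<open>e = ps / (1 + ps)\<close> makes both bounds multiples of \<open>(N/l)^r\<close>, where \<open>1/r = 1/p + s\<close>. For \<open>p = \<infinity>\<close>
  the maximal function never exceeds \<open>N\<close> and only the weight matters.
\<close>

lemma sparse_op_distribution:
  assumes t: "1 < t" and s: "0 < s" "(\<rho> powr (1 - t)) powr (- 1 / s) = \<theta>" and p: "1 \<le> p"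
  obtains B where "0 \<le> B"
    and "\<And>f N l. f \<in> borel_measurable lebesgue \<Longrightarrow> 0 < N \<Longrightarrow>
      L_norm p (\<lambda>x. ennreal (norm (f x))) \<le> ennreal N \<Longrightarrow> 0 < l \<Longrightarrow>
      emeasure lebesgue {x. sparse_op S t f x > ennreal l}
        \<le> ennreal (B * (N / l) powr (1 / (enn2real (1 / p) + s)))"
proof -
  define b where "b = \<rho> powr (1 - t)"
  define C where "C = b / (b - 1)"
  have b: "1 < b"
    using rho t powr_less_mono'[of \<rho> "1 - t" 0] by (simp add: b_def)
  have C: "0 < C" using b by (simp add: C_def)
  have wd: "emeasure lebesgue {x. weight b x > ennreal \<mu>} \<le> ennreal ((C / \<mu>) powr (1 / s))"
    if "0 < \<mu>" for \<mu>
    using weight_distribution[OF b s(1) _ that] s(2) by (simp add: b_def C_def)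
  have split: "emeasure lebesgue {x. sparse_op S t f x > ennreal l}
      \<le> emeasure lebesgue {x. weight b x > ennreal \<mu>}
        + emeasure lebesgue {x. maxfun (\<lambda>y. ennreal (norm (f y))) x > ennreal \<nu>}"
    if "0 < \<mu>" "0 < \<nu>" "\<mu> * \<nu> = l" 
       "{x. maxfun (\<lambda>y. ennreal (norm (f y))) x > ennreal \<nu>} \<in> sets lebesgue" for f l \<mu> \<nu>
  proof -
    have "{x. sparse_op S t f x > ennreal l} \<subseteq> {x. weight b x > ennreal \<mu>}
        \<union> {x. maxfun (\<lambda>y. ennreal (norm (f y))) x > ennreal \<nu>}"
    proof (rule subsetI, rule ccontr)
      fix x
      assume x: "x \<in> {x. sparse_op S t f x > ennreal l}" "x \<notin> {x. weight b x > ennreal \<mu>}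
        \<union> {x. maxfun (\<lambda>y. ennreal (norm (f y))) x > ennreal \<nu>}"
      have "weight b x * maxfun (\<lambda>y. ennreal (norm (f y))) x \<le> ennreal \<mu> * ennreal \<nu>"
        using x(2) by (intro mult_mono) auto
      also have "\<dots> = ennreal l" using that by (simp add: ennreal_mult[symmetric])
      finally show False using x(1) sparse_op_le[OF t, of f x] by (auto simp: b_def)
    qed
    moreover have "{x. weight b x > ennreal \<mu>} \<in> sets lebesgue" 
      by (rule superlevel_set_measurable[OF weight_measurable])
    ultimately show ?thesis
      using that(4) by (intro order_trans[OF emeasure_mono emeasure_subadditive]) auto
  qed
  show thesis
  proof (cases "p = top")
    case True
    show thesis
    proof (rule that[of "C powr (1 / s)"])
      fix f :: "real^'n \<Rightarrow> complex" and N l :: real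
      assume f: "f \<in> borel_measurable lebesgue" and N: "0 < N" and l: "0 < l"
        and norm: "L_norm p (\<lambda>x. ennreal (norm (f x))) \<le> ennreal N"
      have "AE x in lebesgue. ennreal (norm (f x)) \<le> ennreal N"
        using norm True by (intro L_norm_top_le) simp
      then have M: "{x. maxfun (\<lambda>y. ennreal (norm (f y))) x > ennreal N} = {}"
        using maxfun_le_const[of N "\<lambda>y. ennreal (norm (f y))"] N by (auto simp: not_less)
      have "emeasure lebesgue {x. sparse_op S t f x > ennreal l}
          \<le> emeasure lebesgue {x. weight b x > ennreal (l / N)} + emeasure lebesgue ({} :: (real^'n) set)"
        using split[of "l / N" N l f] N l by (simp only: M) simp
      also have "\<dots> \<le> ennreal ((C / (l / N)) powr (1 / s))"
        using wd[of "l / N"] N l by simp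
      also have "(C / (l / N)) powr (1 / s) = C powr (1 / s) * (N / l) powr (1 / (enn2real (1 / p) + s))"
        using C N l True powr_mult[of C "N / l" "1 / s"] by simp
      finally show "emeasure lebesgue {x. sparse_op S t f x > ennreal l}
        \<le> ennreal (C powr (1 / s) * (N / l) powr (1 / (enn2real (1 / p) + s)))" .
    qed simp
  next
    case False
    define P where "P = enn2real p"
    have P: "1 \<le> P" using p False by (cases p) (auto simp: P_def)
    define r where "r = 1 / (enn2real (1 / p) + s)"
    define e where "e = P * s / (1 + P * s)"
    have r: "r = P / (1 + P * s)"
      using P s(1) by (simp add: r_def enn2real_one_divide[OF p False] P_def[symmetric] field_simps)
    have pos: "1 + P * s > 0" using P s(1) by (simp add: add_pos_pos)
    have e: "e * (1 / s) = r" "(1 - e) * P = r"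
      using P s(1) pos by (auto simp: e_def r field_simps)
    show thesis
    proof (rule that[of "C powr (1 / s) + 2 powr P"])
      fix f :: "real^'n \<Rightarrow> complex" and N l :: real
      assume f: "f \<in> borel_measurable lebesgue" and N: "0 < N" and l: "0 < l"
        and norm: "L_norm p (\<lambda>x. ennreal (norm (f x))) \<le> ennreal N"
      let ?g = "\<lambda>y. ennreal (norm (f y))"
      define X where "X = N / l"
      have X: "0 < X" "l = N / X" using N l by (auto simp: X_def)
      define \<mu> where "\<mu> = X powr (- e)"
      have \<mu>: "0 < \<mu>" using X by (simp add: \<mu>_def)
      have int: "(\<integral>\<^sup>+y. ennreal (norm (f y) powr P) \<partial>lebesgue) \<le> ennreal (N powr P)"
        using L_norm_leD[OF p False _ norm] N by (simp add: P_def epowr_def)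
      have "emeasure lebesgue {x. maxfun ?g x > ennreal (l / \<mu>)}
          \<le> ennreal ((2 / (l / \<mu>)) powr P) * (\<integral>\<^sup>+y. ennreal (norm (f y) powr P) \<partial>lebesgue)"
        using f \<mu> l P by (intro maxfun_weak_type) auto
      also have "\<dots> \<le> ennreal ((2 / (l / \<mu>)) powr P) * ennreal (N powr P)"
        by (intro mult_left_mono int) auto
      also have "\<dots> = ennreal ((2 / (l / \<mu>) * N) powr P)"
        by (simp only: powr_mult ennreal_mult[symmetric] powr_ge_zero)
      also have "2 / (l / \<mu>) * N = 2 * X powr (1 - e)"
      proof -
        have "X * \<mu> = X powr (1 - e)" using powr_mult_base[of X "- e"] X(1) by (simp add: \<mu>_def)
        moreover have "2 / (l / \<mu>) * N = 2 * (X * \<mu>)" by (simp add: X_def)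
        ultimately show ?thesis by simp
      qed
      also have "(2 * X powr (1 - e)) powr P = 2 powr P * X powr r"
        using X by (simp add: powr_mult powr_powr e)
      finally have M: "emeasure lebesgue {x. maxfun ?g x > ennreal (l / \<mu>)} \<le> ennreal (2 powr P * X powr r)" .
      have "C / \<mu> = C * X powr e" using X by (simp add: \<mu>_def powr_minus field_simps)
      then have w: "(C / \<mu>) powr (1 / s) = C powr (1 / s) * X powr r"
        using C X e(1) by (simp add: powr_mult powr_powr)
      have "{x. maxfun ?g x > ennreal (l / \<mu>)} \<in> sets lebesgue"
        by (rule superlevel_set_measurable[OF maxfun_measurable])
      then have "emeasure lebesgue {x. sparse_op S t f x > ennreal l}
          \<le> emeasure lebesgue {x. weight b x > ennreal \<mu>} + emeasure lebesgue {x. maxfun ?g x > ennreal (l / \<mu>)}"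
        using l \<mu> by (intro split) auto
      also have "\<dots> \<le> ennreal (C powr (1 / s) * X powr r) + ennreal (2 powr P * X powr r)"
        using wd[OF \<mu>] w by (intro add_mono M) simp
      also have "\<dots> = ennreal ((C powr (1 / s) + 2 powr P) * X powr r)"
        by (simp add: ennreal_plus[symmetric] algebra_simps del: ennreal_plus)
      finally show "emeasure lebesgue {x. sparse_op S t f x > ennreal l}
        \<le> ennreal ((C powr (1 / s) + 2 powr P) * (N / l) powr (1 / (enn2real (1 / p) + s)))"
        by (simp add: X_def r_def)
    qed simp
  qed
qed

end

section \<open>Boundedness of the sparse operator\<close>

context graded_forest
begin

lemma sparse_op_weak_bounded:
  assumes t: "1 < t" and s: "0 < s" "(\<rho> powr (1 - t)) powr (- 1 / s) = \<theta>"
    and p: "1 \<le> p" and q: "enn2real (1 / q) = enn2real (1 / p) + s"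
  shows "bounded_from_L p (weak_L_norm q) (sparse_op S t)"
proof -
  define r where "r = 1 / (enn2real (1 / p) + s)"
  have r: "0 < r" using s(1) by (simp add: r_def add_nonneg_pos)
  obtain B where B: "0 \<le> B" "\<And>f N l. f \<in> borel_measurable lebesgue \<Longrightarrow> 0 < N \<Longrightarrow>
      L_norm p (\<lambda>x. ennreal (norm (f x))) \<le> ennreal N \<Longrightarrow> 0 < l \<Longrightarrow>
      emeasure lebesgue {x. sparse_op S t f x > ennreal l} \<le> ennreal (B * (N / l) powr r)"
    using sparse_op_distribution[OF t s p] unfolding r_def by metis
  show ?thesis
  proof (rule bounded_from_L_I[of "B powr (1 / r)"])
    fix f :: "real^'n \<Rightarrow> complex" and N :: real
    assume "f \<in> borel_measurable lebesgue" "0 < N" "L_norm p (\<lambda>x. ennreal (norm (f x))) \<le> ennreal N"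
    then show "weak_L_norm q (sparse_op S t f) \<le> ennreal (B powr (1 / r) * N)"
      using q by (intro weak_L_norm_leI[OF r]) (auto simp: r_def B(1) intro!: B(2)[unfolded r_def])
  qed (auto intro: sparse_op_measurable)
qed

lemma sparse_op_strong_bounded:
  assumes t: "1 < t" and s: "0 < s" "(\<rho> powr (1 - t)) powr (- 1 / s) = \<theta>"
    and p: "1 \<le> p" and q: "1 \<le> q" "enn2real (1 / q) > enn2real (1 / p) + s"
  shows "bounded_from_L p (L_norm q) (sparse_op S t)"
proof -
  define r where "r = 1 / (enn2real (1 / p) + s)"
  have rpos: "0 < enn2real (1 / p) + s" using s(1) by (simp add: add_nonneg_pos)
  have r: "0 < r" using rpos by (simp add: r_def)
  have qtop: "q \<noteq> top" using q(2) rpos by auto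
  define Q where "Q = enn2real q"
  have Q: "1 \<le> Q" using q(1) qtop by (cases q) (auto simp: Q_def)
  have "enn2real (1 / p) + s < 1 / Q"
    using q(2) enn2real_one_divide[OF q(1) qtop] by (simp add: Q_def)
  then have Qr: "Q < r" using Q rpos by (simp add: r_def field_simps)
  obtain B where B: "0 \<le> B" "\<And>f N l. f \<in> borel_measurable lebesgue \<Longrightarrow> 0 < N \<Longrightarrow>
      L_norm p (\<lambda>x. ennreal (norm (f x))) \<le> ennreal N \<Longrightarrow> 0 < l \<Longrightarrow>
      emeasure lebesgue {x. sparse_op S t f x > ennreal l} \<le> ennreal (B * (N / l) powr r)"
    using sparse_op_distribution[OF t s p] unfolding r_def by metis
  define c where "c = 1 + B * 2 powr Q / (1 - 2 powr (Q - r))"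
  have "(2::real) powr (Q - r) < 1" using Qr powr_less_mono[of "Q - r" 0 2] by simp
  then have c: "0 \<le> c" using B(1) by (simp add: c_def)
  show ?thesis
  proof (rule bounded_from_L_I[of "c powr (1 / Q)"])
    fix f :: "real^'n \<Rightarrow> complex" and N :: real
    assume f: "f \<in> borel_measurable lebesgue" "0 < N" "L_norm p (\<lambda>x. ennreal (norm (f x))) \<le> ennreal N"
    have "(\<integral>\<^sup>+x. epowr (sparse_op S t f x) Q \<partial>lebesgue) \<le> ennreal (N powr Q * c)"
      unfolding c_def
      using Q Qr f B sparse_op_support[OF t, of f] sparse_op_measurable[OF f(1), of t]
      by (intro nn_integral_epowr_le) auto
    then show "L_norm q (sparse_op S t f) \<le> ennreal (c powr (1 / Q) * N)"
      unfolding Q_def using f(2) c q(1) qtop by (intro L_norm_leI) auto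
  qed (auto intro: sparse_op_measurable)
qed

end

section \<open>Size of the cubes and the degree\<close>

lemma side_unit_cube: "side (unit_cube :: (real^'n) set) = 1"
  by (simp add: unit_cube_def side_hcube)

context cube_forest
begin

text \<open>
  Telescoping of the gaps. The convention that a vanishing scale has an infinite gap enters here:
  a finite degree thereby guarantees that no nonempty layer has infimal side length zero.
\<close>

lemma layer_scale_ge:
  assumes "layer S 0 = {unit_cube}" "layer_degree S = ereal K"
  shows "layer S j \<noteq> {} \<Longrightarrow> 2 powr (- K * j) \<le> layer_scale S j"
proof (induction j)
  case 0
  show ?case by (simp add: layer_scale_def assms(1) side_unit_cube)
next
  case (Suc j)
  then obtain Q where "Q \<in> S" "depth Q = Suc j" by (auto simp: layer_eq_depth)
  then have "layer S j \<noteq> {}" using parent[of Q j] by (auto simp: layer_eq_depth)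
  then have IH: "2 powr (- K * j) \<le> layer_scale S j" by (rule Suc.IH)
  have "0 \<le> layer_scale S (Suc j)"
    unfolding layer_scale_def using Suc.prems cube_measure(1)
    by (intro cINF_greatest) (auto simp: layer_eq_depth less_imp_le)
  moreover have gap: "scale_gap S j \<le> ereal K"
    unfolding assms(2)[symmetric] layer_degree_def using Suc.prems by (intro SUP_upper) auto
  then have "layer_scale S (Suc j) \<noteq> 0" by (auto simp: scale_gap_def)
  ultimately have pos: "0 < layer_scale S (Suc j)" by simp
  have pos': "0 < layer_scale S j" using IH by (rule less_le_trans[rotated]) simp
  have "log 2 (layer_scale S j / layer_scale S (Suc j)) \<le> K"
    using gap pos by (simp add: scale_gap_def)
  then have "layer_scale S j / layer_scale S (Suc j) \<le> 2 powr K"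
    using pos pos' by (subst (asm) log_le_iff) auto
  then have "layer_scale S j * 2 powr (- K) \<le> layer_scale S (Suc j)"
    using pos by (simp add: powr_minus field_simps)
  moreover have "2 powr (- K * j) * 2 powr (- K) \<le> layer_scale S j * 2 powr (- K)"
    using IH by (intro mult_right_mono) auto
  moreover have "2 powr (- K * Suc j) = 2 powr (- K * j) * 2 powr (- K)"
    by (simp add: powr_add[symmetric] algebra_simps)
  ultimately show ?case by linarith
qed

lemma measure_ge_degree:
  assumes "layer S 0 = {unit_cube}" "layer_degree S = ereal K" "Q \<in> S"
  shows "(2 powr (- (real CARD('n) * K))) ^ depth Q \<le> measure lebesgue Q"
proof -
  let ?j = "depth Q"
  have Q: "Q \<in> layer S ?j" using assms(3) by (simp add: layer_eq_depth)
  have "2 powr (- K * ?j) \<le> layer_scale S ?j"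
    using Q by (intro layer_scale_ge[OF assms(1,2)]) auto
  also have "\<dots> \<le> side Q"
    unfolding layer_scale_def using Q cube_measure(1)
    by (intro cINF_lower bdd_belowI2[of _ 0]) (auto simp: layer_eq_depth less_imp_le)
  finally have "(2 powr (- K * ?j)) ^ CARD('n) \<le> side Q ^ CARD('n)"
    by (intro power_mono) auto
  moreover have "(2 powr (- K * ?j)) ^ CARD('n) = (2 powr (- (real CARD('n) * K))) ^ ?j"
    by (simp add: powr_realpow[symmetric] powr_powr mult_ac)
  ultimately show ?thesis using cube_measure(2)[OF assms(3)] by simp
qed

lemma graded_forestI:
  assumes root: "layer S 0 = {unit_cube}" and unit: "\<And>Q. Q \<in> S \<Longrightarrow> Q \<subseteq> unit_cube"
    and degree: "layer_degree S = ereal K" "0 < K"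
    and sparse: "contracting_sparse \<eta> S" "0 < \<eta>" "\<eta> < 1"
  shows "graded_forest S (1 - \<eta>) (2 powr (- (real CARD('n) * K)))"
proof -
  let ?\<rho> = "2 powr (- (real CARD('n) * K))"
  note size = measure_ge_degree[OF root degree(1)]
  have fin: "finite (layer S j)" for j
  proof (rule finite_layer[where c = "?\<rho> ^ j"])
    show "unit_cube \<in> sets lebesgue"
      by (simp add: unit_cube_def)
    show "emeasure lebesgue (unit_cube :: (real^'n) set) < \<infinity>"
      unfolding unit_cube_def by (subst emeasure_hcube) auto
  qed (use unit size in \<open>auto simp: layer_eq_depth\<close>)
  have decay: "measure lebesgue (region j) \<le> (1 - \<eta>) ^ j" for j
  proof (induction j)
    case 0
    show ?case by (simp only: region_def root) (simp add: unit_cube_def measure_hcube del: measure_completion)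
  next
    case (Suc j)
    have "measure lebesgue (region (Suc j)) \<le> (1 - \<eta>) * measure lebesgue (region j)"
      by (rule region_decay[OF sparse(1) fin fin])
    also have "\<dots> \<le> (1 - \<eta>) * (1 - \<eta>) ^ j"
      using Suc.IH sparse by (intro mult_left_mono) auto
    finally show ?case by simp
  qed
  have "?\<rho> < 2 powr 0" using degree(2) by (intro powr_less_mono) auto
  then show ?thesis
    using sparse fin decay size by unfold_locales auto
qed

end

section \<open>The bounds up to the critical line\<close>

theorem theorem5p7:
  fixes D S :: "(real^'n) set set" and \<eta> t K :: real
  assumes "0 < \<eta>" and "\<eta> < 1"
    and "dyadic_system D" and "unit_cube \<in> D"
    and "S \<subseteq> D" and "\<forall>Q\<in>S. Q \<subseteq> unit_cube"
    and "layer S 0 = {unit_cube}" and "layer S 1 \<noteq> {}"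
    and "graded S" and "K = real_of_ereal (layer_degree S)"
    and "contracting_sparse \<eta> S"
    and "1 < t" and "t < 1 - log 2 (1 - \<eta>) / (real CARD('n) * K)"
  shows "(\<forall>p q :: ennreal. 1 \<le> p \<and> 1 \<le> q \<and>
           enn2real (1 / q) - enn2real (1 / p) > real CARD('n) * K * (t - 1) / (- log 2 (1 - \<eta>)) \<longrightarrow>
           bounded_from_L p (L_norm q) (sparse_op S t))
    \<and> (\<forall>p q :: ennreal. 1 \<le> p \<and> 1 \<le> q \<and>
           enn2real (1 / q) - enn2real (1 / p) = real CARD('n) * K * (t - 1) / (- log 2 (1 - \<eta>)) \<longrightarrow>
           bounded_from_L p (weak_L_norm q) (sparse_op S t))"
proof -
  let ?n = "real CARD('n)"
  let ?\<rho> = "2 powr (- (?n * K))"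
  define s where "s = ?n * K * (t - 1) / (- log 2 (1 - \<eta>))"
  have n: "0 < ?n" by simp
  have lg: "log 2 (1 - \<eta>) < 0" using assms(1,2) by simp
  \<comment> \<open>Otherwise the upper bound on \<open>t\<close> would be at most \<open>1\<close>; for \<open>K = 0\<close> the quotient has the default value \<open>0\<close>.\<close>
  have K: "0 < K"
  proof (rule ccontr)
    assume "\<not> 0 < K"
    then have "0 \<le> log 2 (1 - \<eta>) / (?n * K)"
      using lg n by (intro divide_nonpos_nonpos) (auto simp: mult_nonneg_nonpos)
    then show False using assms(12,13) by linarith
  qed
  \<comment> \<open>An infinite degree would be converted to the real number \<open>0\<close>.\<close>
  have degree: "layer_degree S = ereal K"
    using K assms(10) by (cases "layer_degree S") auto
  interpret cube_forest S
    using assms(3,5,6) by (intro cube_forest_dyadic) auto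
  interpret graded_forest S "1 - \<eta>" ?\<rho>
    using assms(1,2,6,7,11) K degree by (intro graded_forestI) auto
  have s: "0 < s"
    unfolding s_def using n K assms(12) lg by (intro divide_pos_pos mult_pos_pos) auto
  have "(?\<rho> powr (1 - t)) powr (- 1 / s) = 2 powr (?n * K * (t - 1) * (- 1 / s))"
    by (simp add: powr_powr algebra_simps)
  also have "?n * K * (t - 1) * (- 1 / s) = log 2 (1 - \<eta>)"
    using n K assms(12) lg by (simp add: s_def)
  also have "2 powr log 2 (1 - \<eta>) = 1 - \<eta>" using assms(2) by simp
  finally have \<theta>: "(?\<rho> powr (1 - t)) powr (- 1 / s) = 1 - \<eta>" .
  show ?thesis
    unfolding s_def[symmetric]
    by (intro conjI allI impI)
      (auto intro!: sparse_op_strong_bounded[OF assms(12) s \<theta>] sparse_op_weak_bounded[OF assms(12) s \<theta>])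
qed

end
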